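(* Let $d\ge 1$, let $\mu\in\mathbb{R}^d$ be a deterministic vector, let $R$ be a $d\times d$ symmetric positive definite matrix, and let $$\phi_R(x)=\frac{1}{|2\pi R|^{1/2}}\exp\left(-\tfrac12 x^tR^{-1}x\right),\qquad x\in\mathbb{R}^d,$$ be the $d$-variate Gaussian density with zero mean and covariance matrix $R$ (where $|\cdot|$ denotes the determinant). Let $X\in\mathbb{R}^d$ be a random vector with probability density $$f_X(x)=\tfrac12\phi_R(x+\mu)+\tfrac12\phi_R(x-\mu),$$ and let $\zeta\in\mathbb{R}^d$ be a zero-mean Gaussian vector with covariance matrix $R$. If $A=\{\alpha_1,\dots,\alpha_{2N}\}$ is a set of integers (repetitions allowed) with $1\le\alpha_i\le d$ for all $i$, then $$\mathbb{E}X_A=\sum_{k=0}^{N}\ \sum_{\substack{S\subset A\\ |S|=2k}}\mu_S\ \underset{A\backslash S}{\sum\prod}\,\mathbb{E}(\zeta_i\zeta_j).$$ If $A=\{\alpha_1,\dots,\alpha_{2N+1}\}$ with $1\le\alpha_i\le d$ for all $i$, then $\mathbb{E}X_A=0$.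
   Context: Multi-index notation: a "set" $A=\{\alpha_1,\dots,\alpha_n\}$ of integers with $1\le\alpha_i\le d$ is a finite indexed family in which the $\alpha_i$ need not be distinct. Subsets $S\subset A$, complements $A\backslash S$, cardinalities and pairings are taken with respect to the positions $1,\dots,n$ (so repeated values count as different elements; e.g. a subset $S$ corresponds to a subset $I\subset\{1,\dots,n\}$, and $|S|=|I|$). For a vector $v\in\mathbb{R}^d$ (deterministic or random), $v_A=\prod_{i=1}^n v_{\alpha_i}$, with the convention $v_\emptyset=1$; similarly $v_S=\prod_{i\in I}v_{\alpha_i}$. A pairing of $A$ is a partition of (the positions of) $A$ into disjoint pairs; $\Pi(A)$ is the set of all pairings of $A$. It is empty if $|A|$ is odd, and for $A=\emptyset$ it consists of the single empty pairing. For a random vector $Y\in\mathbb{R}^d$, $$\underset{A}{\sum\prod}\,\mathbb{E}(Y_iY_j):=\sum_{\sigma\in\Pi(A)}\ \prod_{\{a,b\}\in\sigma}\mathbb{E}(Y_{\alpha_a}Y_{\alpha_b}),$$ i.e. the sum over all pairings of the product, over pairs of the pairing, of the second moments of the paired components (equal to $1$ when $A=\emptyset$). For example, $\underset{\{1,1,2,4\}}{\sum\prod}\mathbb{E}(Y_iY_j)=\mathbb{E}(Y_1^2)\mathbb{E}(Y_2Y_4)+2\,\mathbb{E}(Y_1Y_2)\mathbb{E}(Y_1Y_4)$. *)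

theory Defs
  imports "HOL-Probability.Probability"
begin

definition sym_pos_def :: "real^'d^'d \<Rightarrow> bool" where
  "sym_pos_def R \<longleftrightarrow> transpose R = R \<and> (\<forall>x. x \<noteq> 0 \<longrightarrow> x \<bullet> (R *v x) > 0)"

definition gauss_density :: "real^'d^'d \<Rightarrow> real^'d \<Rightarrow> real" where
  "gauss_density R x =
     1 / sqrt (det ((2 * pi) *\<^sub>R R)) * exp (- (1 / 2) * (x \<bullet> (matrix_inv R *v x)))"

definition mixture_density :: "real^'d^'d \<Rightarrow> real^'d \<Rightarrow> real^'d \<Rightarrow> real" where
  "mixture_density R \<mu> x = 1 / 2 * gauss_density R (x + \<mu>) + 1 / 2 * gauss_density R (x - \<mu>)"

text \<open>
  An indexed family of coordinates, with repetitions allowed, is a function \<open>\<alpha>\<close> from positions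
  to coordinates. Subfamilies are sets of positions \<open>I\<close>, so that equal values at different positions
  count as different elements; values of \<open>\<alpha>\<close> outside \<open>I\<close> are irrelevant.
\<close>

definition vec_prod :: "real^'d \<Rightarrow> (nat \<Rightarrow> 'd) \<Rightarrow> nat set \<Rightarrow> real" where
  "vec_prod v \<alpha> I = (\<Prod>i\<in>I. v $ \<alpha> i)"

definition pairings :: "nat set \<Rightarrow> nat set set set" where
  "pairings I = {\<sigma>. partition_on I \<sigma> \<and> (\<forall>p\<in>\<sigma>. card p = 2)}"

text \<open>
  For a pair \<open>p = {a, b}\<close> of distinct positions, \<open>vec_prod v \<alpha> p\<close> is \<open>v $ \<alpha> a * v $ \<alpha> b\<close>,
  so every factor below is the second moment of the two paired components.
\<close>

definition sum_prod_pairings ::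
  "'w measure \<Rightarrow> ('w \<Rightarrow> real^'d) \<Rightarrow> (nat \<Rightarrow> 'd) \<Rightarrow> nat set \<Rightarrow> real" where
  "sum_prod_pairings M Y \<alpha> I =
     (\<Sum>\<sigma>\<in>pairings I. \<Prod>p\<in>\<sigma>. prob_space.expectation M (\<lambda>\<omega>. vec_prod (Y \<omega>) \<alpha> p))"

end

theory Submission imports Defs begin

text \<open>
  The density of \<open>X\<close> is the average of two translates of \<open>\<phi>\<close>, the Gaussian density with matrix \<open>R\<close>,
  so by translation invariance of Lebesgue measure a moment of \<open>X\<close> is the average of the
  \<open>\<phi>\<close>-means of \<open>(\<mu> + x)\<^sub>A\<close> and \<open>(- \<mu> + x)\<^sub>A\<close>. Multiplying these products out over
  subsets \<open>S\<close> of positions, the sign \<open>(-1)\<close> to the power \<open>card S\<close> cancels the odd subsets and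
  leaves \<open>\<mu>\<^sub>S\<close> times the moment of \<open>\<zeta>\<close> over \<open>A - S\<close> for the even ones
  (\<open>integral_mixture_vec_prod\<close>). Everything then rests on the pairing formula of Isserlis and Wick
  for \<open>\<zeta>\<close> (\<open>gauss_mean_wick\<close>), which also makes the odd moments vanish.

  The pairing formula comes from one identity. Completing the square shows that translating \<open>\<phi>\<close> by
  \<open>R s\<close> multiplies it by \<open>exp (s \<bullet> x - (s \<bullet> R s) / 2)\<close> (\<open>gauss_density_translate\<close>). Since a
  translate has the same integral, this gives two things. First, all exponential moments are finite,
  and so every polynomial is integrable. Secondly, for a polynomial \<open>g\<close> the mean of
  \<open>g x * exp (s \<bullet> x)\<close> equals \<open>exp ((s \<bullet> R s) / 2)\<close> times the mean of \<open>g (x + R s)\<close>. Taking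
  \<open>s = t e\<^sub>k\<close> and comparing derivatives at \<open>t = 0\<close> yields Gaussian integration by parts,
  \<open>E (x\<^sub>J x\<^sub>k) = (\<Sum>j\<in>J. R\<^sub>j\<^sub>k * E x\<^bsub>J - {j}\<^esub>)\<close>
  (\<open>gauss_mean_integration_by_parts\<close>). Pairings satisfy the same recursion: choose the partner
  \<open>j\<close> of one fixed position, then pair up the remaining ones (\<open>sum_pairings_insert\<close>).

  No Gaussian integral is evaluated and \<open>R\<close> is never diagonalised: the normalisation of \<open>\<phi>\<close> is known
  because it is the density of \<open>\<zeta>\<close>, and the case \<open>J = {j}\<close> of the recursion identifies the entries of
  \<open>R\<close> with the second moments.
\<close>

section \<open>Subset expansions and pairings\<close>

lemma vec_prod_empty [simp]: "vec_prod v \<alpha> {} = 1"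
  by (simp add: vec_prod_def)

lemma vec_prod_insert:
  assumes "finite I" "k \<notin> I"
  shows "vec_prod v \<alpha> (insert k I) = v $ \<alpha> k * vec_prod v \<alpha> I"
  using assms by (simp add: vec_prod_def)

lemma vec_prod_add:
  assumes "finite I"
  shows "vec_prod (v + w) \<alpha> I = (\<Sum>S\<in>Pow I. vec_prod v \<alpha> S * vec_prod w \<alpha> (I - S))"
  using prod_add[OF assms, of "\<lambda>i. v $ \<alpha> i" "\<lambda>i. w $ \<alpha> i"] by (simp add: vec_prod_def)

lemma vec_prod_scaleR: "vec_prod (t *\<^sub>R v) \<alpha> I = t ^ card I * vec_prod v \<alpha> I"
  by (simp add: vec_prod_def prod.distrib)

lemma vec_prod_minus: "vec_prod (- v) \<alpha> I = (- 1) ^ card I * vec_prod v \<alpha> I"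
  using vec_prod_scaleR[of "- 1" v] by simp

lemma borel_measurable_vec_prod [measurable]: "(\<lambda>x. vec_prod x \<alpha> I) \<in> borel_measurable borel"
  unfolding vec_prod_def by measurable

lemma sum_even_subsets_by_card:
  fixes f :: "'i set \<Rightarrow> real"
  assumes "finite I" "card I = 2 * N"
  shows "(\<Sum>S | S \<subseteq> I \<and> even (card S). f S) = (\<Sum>k = 0..N. \<Sum>S | S \<subseteq> I \<and> card S = 2 * k. f S)"
proof -
  have "(\<Sum>k = 0..N. \<Sum>S | S \<in> {S. S \<subseteq> I \<and> even (card S)} \<and> card S div 2 = k. f S) =
      (\<Sum>S | S \<subseteq> I \<and> even (card S). f S)"
  proof (rule sum.group)
    show "(\<lambda>S. card S div 2) ` {S. S \<subseteq> I \<and> even (card S)} \<subseteq> {0..N}"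
    proof (rule image_subsetI)
      fix S assume "S \<in> {S. S \<subseteq> I \<and> even (card S)}"
      then have "card S \<le> 2 * N"
        using card_mono[OF assms(1), of S] assms(2) by simp
      then show "card S div 2 \<in> {0..N}"
        by simp
    qed
  qed (use assms in auto)
  moreover have "{S \<in> {S. S \<subseteq> I \<and> even (card S)}. card S div 2 = k} = {S. S \<subseteq> I \<and> card S = 2 * k}" for k
    by auto
  ultimately show ?thesis
    by simp
qed

lemma pairings_empty: "pairings {} = {{}}"
  by (auto simp: pairings_def partition_on_empty)

lemma finite_pairings: "finite I \<Longrightarrow> finite (pairings I)"
  by (rule finite_subset[of _ "Pow (Pow I)"]) (auto simp: pairings_def partition_on_def)

text \<open>
  The second claim says that the added pair is new, so that a product over the enlarged pairing
  splits off exactly one factor, and that \<open>\<sigma>\<close> can be recovered from it.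
\<close>

lemma insert_pair_in_pairings:
  assumes "k \<notin> J" "j \<in> J" "\<sigma> \<in> pairings (J - {j})"
  shows "insert {k, j} \<sigma> \<in> pairings (insert k J)" "{k, j} \<notin> \<sigma>"
proof -
  have p: "partition_on (J - {j}) \<sigma>" "\<forall>p\<in>\<sigma>. card p = 2"
    using assms(3) by (auto simp: pairings_def)
  have U: "\<Union>\<sigma> = J - {j}"
    using p(1) by (simp add: partition_on_def)
  have "disjnt {k, j} (\<Union>\<sigma>)"
    using U assms by (auto simp: disjnt_def)
  moreover have "insert k J - {k, j} = J - {j}"
    using assms by auto
  ultimately have "partition_on (insert k J) (insert {k, j} \<sigma>)"
    using p assms by (simp add: partition_on_insert)
  moreover have "card {k, j} = 2"
    using assms by (auto simp: card_insert_if)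
  ultimately show "insert {k, j} \<sigma> \<in> pairings (insert k J)"
    using p by (auto simp: pairings_def)
  show "{k, j} \<notin> \<sigma>"
    using U by auto
qed

text \<open>
  A pairing of \<open>insert k J\<close> is determined by the partner \<open>j\<close> of \<open>k\<close> and a pairing of what is left.
\<close>

lemma pairings_insert:
  assumes "k \<notin> J"
  shows "pairings (insert k J) = (\<Union>j\<in>J. insert {k, j} ` pairings (J - {j}))"
proof (intro equalityI subsetI)
  fix \<sigma> assume \<sigma>: "\<sigma> \<in> pairings (insert k J)"
  have p: "partition_on (insert k J) \<sigma>" "\<forall>p\<in>\<sigma>. card p = 2"
    using \<sigma> by (auto simp: pairings_def)
  then obtain q where q: "q \<in> \<sigma>" "k \<in> q"
    by (auto simp: partition_on_def)
  then have "card q = 2"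
    using p(2) by blast
  then obtain a b where "q = {a, b}" "a \<noteq> b"
    by (auto simp: card_2_iff)
  then have "q = {k, if k = a then b else a}" "(if k = a then b else a) \<noteq> k"
    using q(2) by auto
  then obtain j where j: "q = {k, j}" "j \<noteq> k"
    by blast
  have jJ: "j \<in> J"
    using j q p(1) by (auto simp: partition_on_def)
  have ins: "\<sigma> = insert q (\<sigma> - {q})"
    using q by auto
  have "disjnt q (\<Union>(\<sigma> - {q}))"
    using p(1) q(1) by (auto simp: partition_on_def disjnt_def pairwise_def)
  then have "partition_on (insert k J - q) (\<sigma> - {q})"
    using p(1) ins partition_on_insert by metis
  moreover have "insert k J - q = J - {j}"
    using j assms by auto
  ultimately have "\<sigma> - {q} \<in> pairings (J - {j})"
    using p(2) by (auto simp: pairings_def)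
  then show "\<sigma> \<in> (\<Union>j\<in>J. insert {k, j} ` pairings (J - {j}))"
    using jJ ins j by blast
qed (use insert_pair_in_pairings[OF assms] in blast)

text \<open>
  The partner of \<open>k\<close> is unique, so the union in \<open>pairings_insert\<close> is disjoint. The resulting recursion
  has the same form as integration by parts for Gaussian moments.
\<close>

lemma sum_pairings_insert:
  fixes w :: "nat set \<Rightarrow> real"
  assumes "finite J" "k \<notin> J"
  shows "(\<Sum>\<sigma>\<in>pairings (insert k J). \<Prod>p\<in>\<sigma>. w p) =
    (\<Sum>j\<in>J. w {k, j} * (\<Sum>\<sigma>\<in>pairings (J - {j}). \<Prod>p\<in>\<sigma>. w p))"
proof -
  have fin: "finite \<sigma>" if "\<sigma> \<in> pairings (J - {j})" for \<sigma> j
    using that assms(1) finite_elements[of "J - {j}" \<sigma>] by (simp add: pairings_def)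
  have noK: "k \<notin> \<Union>\<sigma>" if "\<sigma> \<in> pairings (J - {j})" for \<sigma> j
    using that assms(2) by (auto simp: pairings_def partition_on_def)
  have inj: "inj_on (insert {k, j}) (pairings (J - {j}))" if "j \<in> J" for j
    using insert_pair_in_pairings(2)[OF assms(2) that] by (intro inj_onI) (metis insert_ident)
  have disj: "insert {k, i} ` pairings (J - {i}) \<inter> insert {k, j} ` pairings (J - {j}) = {}"
    if "i \<in> J" "j \<in> J" "i \<noteq> j" for i j
  proof -
    { fix \<sigma> \<tau> assume st: "\<sigma> \<in> pairings (J - {i})" "\<tau> \<in> pairings (J - {j})"
        and eq: "insert {k, i} \<sigma> = insert {k, j} \<tau>"
      have "{k, i} \<in> insert {k, j} \<tau>"
        using eq by auto
      then have "{k, i} = {k, j}"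
        using noK[OF st(2)] by auto
      then have False
        using that assms(2) by (auto simp: doubleton_eq_iff) }
    then show ?thesis by blast
  qed
  have "(\<Sum>\<sigma>\<in>pairings (insert k J). \<Prod>p\<in>\<sigma>. w p) =
      (\<Sum>j\<in>J. \<Sum>\<sigma>\<in>insert {k, j} ` pairings (J - {j}). \<Prod>p\<in>\<sigma>. w p)"
    unfolding pairings_insert[OF assms(2)]
    by (rule sum.UNION_disjoint) (use assms(1) disj finite_pairings in auto)
  also have "\<dots> = (\<Sum>j\<in>J. \<Sum>\<sigma>\<in>pairings (J - {j}). \<Prod>p\<in>insert {k, j} \<sigma>. w p)"
    by (rule sum.cong[OF refl]) (simp add: sum.reindex[OF inj])
  also have "\<dots> = (\<Sum>j\<in>J. \<Sum>\<sigma>\<in>pairings (J - {j}). w {k, j} * (\<Prod>p\<in>\<sigma>. w p))"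
    using insert_pair_in_pairings(2)[OF assms(2)] fin
    by (intro sum.cong refl) (simp add: prod.insert)
  finally show ?thesis
    by (simp add: sum_distrib_left)
qed

section \<open>Translations of the Gaussian density\<close>

lemma
  fixes f :: "'n::euclidean_space \<Rightarrow> real"
  assumes [measurable]: "f \<in> borel_measurable borel"
  shows integral_lborel_translate: "(\<integral>x. f (x + c) \<partial>lborel) = (\<integral>x. f x \<partial>lborel)"
    and integrable_lborel_translate:
      "integrable lborel (\<lambda>x. f (x + c)) \<longleftrightarrow> integrable lborel f"
proof -
  have "(\<integral>x. f x \<partial>distr lborel borel ((+) c)) = (\<integral>x. f (c + x) \<partial>lborel)"
    by (rule integral_distr) auto
  then show "(\<integral>x. f (x + c) \<partial>lborel) = (\<integral>x. f x \<partial>lborel)"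
    by (simp add: lborel_distr_plus add.commute)
  have "integrable (distr lborel borel ((+) c)) f \<longleftrightarrow> integrable lborel (\<lambda>x. f (c + x))"
    by (rule integrable_distr_eq) auto
  then show "integrable lborel (\<lambda>x. f (x + c)) \<longleftrightarrow> integrable lborel f"
    by (simp add: lborel_distr_plus add.commute)
qed

lemma inner_matrix_vector_transpose:
  fixes A :: "real^'n^'m"
  shows "x \<bullet> (A *v y) = (transpose A *v x) \<bullet> y"
  by (metis dot_lmul_matrix transpose_matrix_vector)

text \<open>
  A vector in the kernel of \<open>R\<close> makes the quadratic form vanish, hence is zero, so \<open>R\<close> is invertible.
\<close>

lemma sym_pos_def_matrix_inv:
  fixes R :: "real^'d^'d"
  assumes "sym_pos_def R"
  shows "R ** matrix_inv R = mat 1" "matrix_inv R ** R = mat 1"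
    "transpose (matrix_inv R) = matrix_inv R"
proof -
  have sym: "transpose R = R" and pos: "\<And>x. x \<noteq> 0 \<Longrightarrow> x \<bullet> (R *v x) > 0"
    using assms by (auto simp: sym_pos_def_def)
  have "x = 0" if "R *v x = 0" for x
    using pos[of x] that by force
  then have inv: "invertible R"
    by (simp add: invertible_left_inverse matrix_left_invertible_ker)
  show 1: "R ** matrix_inv R = mat 1" and 2: "matrix_inv R ** R = mat 1"
    using inv unfolding invertible_def matrix_inv_def by (metis (mono_tags, lifting) someI_ex)+
  have "transpose (matrix_inv R) ** R = mat 1"
    using arg_cong[OF 1, of transpose] by (simp add: matrix_transpose_mul sym transpose_mat)
  then show "transpose (matrix_inv R) = matrix_inv R"
    using 1 2 by (metis matrix_mul_assoc matrix_mul_lid matrix_mul_rid)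
qed

text \<open>
  Completing the square. The translation is by \<open>R s\<close>, and not by \<open>s\<close>, because \<open>matrix_inv R\<close> then
  cancels in the mixed term and leaves the plain exponential \<open>exp (s \<bullet> x)\<close>.
\<close>

lemma gauss_density_translate:
  fixes R :: "real^'d^'d"
  assumes "sym_pos_def R"
  shows "gauss_density R (x - R *v s) =
    exp (- (1 / 2) * (s \<bullet> (R *v s))) * (gauss_density R x * exp (s \<bullet> x))"
proof -
  let ?Q = "matrix_inv R"
  note inv = sym_pos_def_matrix_inv[OF assms]
  have QR: "?Q *v (R *v s) = s"
    by (simp add: matrix_vector_mul_assoc inv)
  have cross: "(R *v s) \<bullet> (?Q *v x) = s \<bullet> x"
    by (simp add: inner_matrix_vector_transpose inv QR)
  have "(x - R *v s) \<bullet> (?Q *v (x - R *v s)) = x \<bullet> (?Q *v x) - 2 * (s \<bullet> x) + s \<bullet> (R *v s)"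
    by (simp add: matrix_vector_mult_diff_distrib inner_diff_left inner_diff_right QR cross)
      (simp add: inner_commute)
  then have "- (1 / 2) * ((x - R *v s) \<bullet> (?Q *v (x - R *v s))) =
      - (1 / 2) * (s \<bullet> (R *v s)) + (- (1 / 2) * (x \<bullet> (?Q *v x)) + s \<bullet> x)"
    by linarith
  then show ?thesis
    by (simp only: gauss_density_def exp_add mult_ac)
qed

lemma borel_measurable_matrix_vector_mult [measurable]:
  fixes A :: "real^'n^'m"
  shows "(\<lambda>x. A *v x) \<in> borel_measurable borel"
  by (intro borel_measurable_continuous_onI continuous_intros matrix_vector_mult_linear_continuous_on)

lemma borel_measurable_gauss_density [measurable]:
  fixes R :: "real^'d^'d"
  shows "gauss_density R \<in> borel_measurable borel"
  unfolding gauss_density_def[abs_def] by measurable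

text \<open>
  Having total mass one is taken as part of the setting: it holds whenever some random vector has
  this density, and it replaces the evaluation of the Gaussian integral.
\<close>

locale gaussian_law =
  fixes R :: "real^'d^'d"
  assumes sym_pos_def: "sym_pos_def R"
    and total_mass: "(\<integral>\<^sup>+x. ennreal (gauss_density R x) \<partial>lborel) = 1"
begin

text \<open>
  Only the normalising constant could be negative, as \<open>sqrt\<close> maps negative reals to negative reals.
  But then the density would be at most zero everywhere, contradicting total mass one.
\<close>

lemma gauss_density_nonneg: "0 \<le> gauss_density R x"
proof (rule ccontr)
  assume "\<not> 0 \<le> gauss_density R x"
  then have "1 / sqrt (det ((2 * pi) *\<^sub>R R)) \<le> 0"
    by (metis exp_ge_zero gauss_density_def linear mult_nonneg_nonneg)
  then have "gauss_density R y \<le> 0" for y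
    unfolding gauss_density_def by (intro mult_nonpos_nonneg) auto
  then show False
    using total_mass by (simp add: ennreal_neg)
qed

definition gauss_mean :: "(real^'d \<Rightarrow> real) \<Rightarrow> real" where
  "gauss_mean f = (\<integral>x. gauss_density R x * f x \<partial>lborel)"

lemma integrable_gauss_density: "integrable lborel (gauss_density R)"
  and gauss_mean_one: "gauss_mean (\<lambda>_. 1) = 1"
  using total_mass gauss_density_nonneg
  by (auto simp: gauss_mean_def integral_eq_nn_integral intro!: integrableI_nonneg)

text \<open>
  Up to a constant this function is a translate of the density.
\<close>

lemma integrable_gauss_exp: "integrable lborel (\<lambda>x. gauss_density R x * exp (s \<bullet> x))"
proof -
  have "integrable lborel (\<lambda>x. gauss_density R (x - R *v s))"
    using integrable_lborel_translate[of "gauss_density R" "- (R *v s)"] integrable_gauss_density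
    by simp
  then show ?thesis
    by (simp add: gauss_density_translate[OF sym_pos_def])
qed

text \<open>
  The sum of the \<open>\<bar>x $ i\<bar>\<close> is the largest value of \<open>s \<bullet> x\<close> over the sign vectors \<open>s\<close>, attained at the
  one matching \<open>x\<close>. So the exponential here is one of the finitely many \<open>exp (B * (s \<bullet> x))\<close> and is
  dominated by their sum. It serves as the universal dominating function below.
\<close>

lemma integrable_gauss_exp_abs:
  "integrable lborel (\<lambda>x. gauss_density R x * exp (B * (\<Sum>i\<in>UNIV. \<bar>x $ i\<bar>)))"
proof (rule Bochner_Integration.integrable_bound)
  let ?s = "\<lambda>S. (\<chi> i. if i \<in> S then B else - B) :: real^'d"
  show "integrable lborel (\<lambda>x. \<Sum>S\<in>UNIV. gauss_density R x * exp (?s S \<bullet> x))"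
    by (intro Bochner_Integration.integrable_sum integrable_gauss_exp)
  show "AE x in lborel. norm (gauss_density R x * exp (B * (\<Sum>i\<in>UNIV. \<bar>x $ i\<bar>)))
      \<le> norm (\<Sum>S\<in>UNIV. gauss_density R x * exp (?s S \<bullet> x))"
  proof (rule AE_I2)
    fix x :: "real^'d"
    \<comment> \<open>the coordinates at which the matching sign vector is positive\<close>
    let ?S = "{i. 0 \<le> x $ i}"
    have "B * (\<Sum>i\<in>UNIV. \<bar>x $ i\<bar>) = ?s ?S \<bullet> x"
      by (auto simp: inner_vec_def sum_distrib_left intro!: sum.cong)
    then have "gauss_density R x * exp (B * (\<Sum>i\<in>UNIV. \<bar>x $ i\<bar>))
        \<le> (\<Sum>S\<in>UNIV. gauss_density R x * exp (?s S \<bullet> x))"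
      using member_le_sum[of ?S UNIV "\<lambda>S. gauss_density R x * exp (?s S \<bullet> x)"]
      by (simp add: gauss_density_nonneg)
    then show "norm (gauss_density R x * exp (B * (\<Sum>i\<in>UNIV. \<bar>x $ i\<bar>)))
        \<le> norm (\<Sum>S\<in>UNIV. gauss_density R x * exp (?s S \<bullet> x))"
      using gauss_density_nonneg[of x] by (simp add: sum_nonneg)
  qed
qed measurable

lemma abs_vec_prod_le:
  "\<bar>vec_prod x \<alpha> I\<bar> \<le> exp (real (card I) * (\<Sum>i\<in>UNIV. \<bar>x $ i\<bar>))"
proof -
  have "\<bar>x $ \<alpha> i\<bar> \<le> exp (\<Sum>i\<in>UNIV. \<bar>x $ i\<bar>)" for i
  proof -
    have "\<bar>x $ \<alpha> i\<bar> \<le> (\<Sum>i\<in>UNIV. \<bar>x $ i\<bar>)"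
      by (rule member_le_sum) auto
    also have "\<dots> \<le> exp (\<Sum>i\<in>UNIV. \<bar>x $ i\<bar>)"
      using exp_ge_add_one_self[of "\<Sum>i\<in>UNIV. \<bar>x $ i\<bar>"] by linarith
    finally show ?thesis .
  qed
  then have "(\<Prod>i\<in>I. \<bar>x $ \<alpha> i\<bar>) \<le> (\<Prod>i\<in>I. exp (\<Sum>i\<in>UNIV. \<bar>x $ i\<bar>))"
    by (intro prod_mono) auto
  then show ?thesis
    by (simp add: vec_prod_def abs_prod exp_of_nat_mult)
qed

lemma integrable_gauss_exp_bound:
  assumes [measurable]: "g \<in> borel_measurable borel"
    and "\<And>x. \<bar>g x\<bar> \<le> exp (B * (\<Sum>i\<in>UNIV. \<bar>x $ i\<bar>))"
  shows "integrable lborel (\<lambda>x. gauss_density R x * g x)"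
  by (rule Bochner_Integration.integrable_bound[OF integrable_gauss_exp_abs[of B]])
    (use assms gauss_density_nonneg in \<open>auto simp: abs_mult intro!: mult_left_mono\<close>)

lemma integrable_gauss_vec_prod: "integrable lborel (\<lambda>x. gauss_density R x * vec_prod x \<alpha> I)"
  by (rule integrable_gauss_exp_bound[OF _ abs_vec_prod_le]) measurable

lemma
  assumes "finite I"
  shows integrable_gauss_vec_prod_add:
      "integrable lborel (\<lambda>x. gauss_density R x * vec_prod (v + x) \<alpha> I)"
    and gauss_mean_vec_prod_add:
      "gauss_mean (\<lambda>x. vec_prod (v + x) \<alpha> I) =
        (\<Sum>S\<in>Pow I. vec_prod v \<alpha> S * gauss_mean (\<lambda>x. vec_prod x \<alpha> (I - S)))"
proof -
  have expand: "gauss_density R x * vec_prod (v + x) \<alpha> I =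
      (\<Sum>S\<in>Pow I. vec_prod v \<alpha> S * (gauss_density R x * vec_prod x \<alpha> (I - S)))" for x
    by (simp add: vec_prod_add[OF assms] sum_distrib_left mult_ac)
  show "integrable lborel (\<lambda>x. gauss_density R x * vec_prod (v + x) \<alpha> I)"
    unfolding expand
    by (intro Bochner_Integration.integrable_sum integrable_mult_right integrable_gauss_vec_prod)
  show "gauss_mean (\<lambda>x. vec_prod (v + x) \<alpha> I) =
      (\<Sum>S\<in>Pow I. vec_prod v \<alpha> S * gauss_mean (\<lambda>x. vec_prod x \<alpha> (I - S)))"
    unfolding gauss_mean_def expand
    by (subst Bochner_Integration.integral_sum)
      (simp_all add: integrable_mult_right integrable_gauss_vec_prod)
qed

text \<open>
  The Cameron--Martin formula: tilting a Gaussian law by an exponential shifts it.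
\<close>

lemma gauss_mean_translate:
  assumes [measurable]: "g \<in> borel_measurable borel"
  shows "gauss_mean (\<lambda>x. g x * exp (s \<bullet> x)) =
    exp (1 / 2 * (s \<bullet> (R *v s))) * gauss_mean (\<lambda>x. g (R *v s + x))"
proof -
  have "gauss_mean (\<lambda>x. g (R *v s + x)) = (\<integral>x. gauss_density R (x - R *v s) * g x \<partial>lborel)"
    using integral_lborel_translate[of "\<lambda>x. gauss_density R (x - R *v s) * g x" "R *v s"]
    by (simp add: gauss_mean_def add.commute)
  also have "\<dots> = exp (- (1 / 2) * (s \<bullet> (R *v s))) * gauss_mean (\<lambda>x. g x * exp (s \<bullet> x))"
    unfolding gauss_mean_def integral_mult_right_zero[symmetric]
    by (intro Bochner_Integration.integral_cong refl)
      (simp add: gauss_density_translate[OF sym_pos_def] mult_ac)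
  finally show ?thesis
    by (simp add: exp_minus)
qed

section \<open>Integration by parts and the pairing formula\<close>

text \<open>
  A bound uniform in \<open>t\<close>, which allows differentiation at \<open>t = 0\<close> under the integral sign.
\<close>

lemma abs_exp_difference_quotient_le:
  fixes t u :: real
  assumes "0 < t" "t \<le> 1"
  shows "\<bar>(exp (t * u) - 1) / t\<bar> \<le> exp (2 * \<bar>u\<bar>)"
proof -
  have "\<bar>exp y - 1\<bar> \<le> \<bar>y\<bar> * exp \<bar>y\<bar>" for y :: real
  proof (cases "0 \<le> y")
    case True
    have "exp y * (1 - y) \<le> exp y * exp (- y)"
      using exp_ge_add_one_self[of "- y"] by (intro mult_left_mono) auto
    then show ?thesis
      using True by (simp add: exp_minus algebra_simps)
  next
    case False
    have "1 - exp y \<le> - y"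
      using exp_ge_add_one_self[of y] by linarith
    also have "\<dots> \<le> - y * exp (- y)"
      using False by (intro mult_le_cancel_left1[THEN iffD2]) auto
    finally show ?thesis
      using False by simp
  qed
  from this[of "t * u"] have "\<bar>exp (t * u) - 1\<bar> / t \<le> \<bar>u\<bar> * exp (t * \<bar>u\<bar>)"
    using assms by (simp add: abs_mult field_simps)
  also have "\<dots> \<le> exp \<bar>u\<bar> * exp \<bar>u\<bar>"
  proof (rule mult_mono)
    show "\<bar>u\<bar> \<le> exp \<bar>u\<bar>"
      using exp_ge_add_one_self[of "\<bar>u\<bar>"] by linarith
    show "exp (t * \<bar>u\<bar>) \<le> exp \<bar>u\<bar>"
      using assms by (simp add: mult_left_le_one_le)
  qed auto
  finally show ?thesis
    using assms by (simp add: exp_add[symmetric])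
qed

text \<open>
  Differentiation of the tilted moment under the integral sign at \<open>t = 0\<close>. Limits are taken along the
  sequence \<open>1 / (n + 1)\<close>, which suits dominated convergence and still determines the derivative.
\<close>

lemma gauss_mean_exp_quotient_tendsto:
  defines "t \<equiv> \<lambda>n. 1 / real (Suc n)"
  shows "(\<lambda>n. (gauss_mean (\<lambda>x. vec_prod x \<alpha> I * exp (t n * x $ k)) -
        gauss_mean (\<lambda>x. vec_prod x \<alpha> I)) / t n)
      \<longlonglongrightarrow> gauss_mean (\<lambda>x. vec_prod x \<alpha> I * x $ k)"
proof -
  let ?L = "\<lambda>x::real^'d. \<Sum>i\<in>UNIV. \<bar>x $ i\<bar>"
  have t: "0 < t n" "t n \<le> 1" for n
    by (auto simp: t_def)
  have t0: "t \<longlonglongrightarrow> 0"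
    unfolding t_def using LIMSEQ_Suc[OF lim_1_over_n] by simp
  have kL: "\<bar>x $ k\<bar> \<le> ?L x" for x :: "real^'d"
    by (rule member_le_sum) auto
  have q: "gauss_mean (\<lambda>x. vec_prod x \<alpha> I * ((exp (t n * x $ k) - 1) / t n)) =
      (gauss_mean (\<lambda>x. vec_prod x \<alpha> I * exp (t n * x $ k)) - gauss_mean (\<lambda>x. vec_prod x \<alpha> I)) / t n"
    for n
  proof -
    have "integrable lborel (\<lambda>x. gauss_density R x * (vec_prod x \<alpha> I * exp (t n * x $ k)))"
    proof (rule integrable_gauss_exp_bound)
      fix x :: "real^'d"
      have "t n * x $ k \<le> ?L x"
        using kL[of x] t[of n] mult_right_mono[of "t n" 1 "\<bar>x $ k\<bar>"]
          mult_left_mono[of "x $ k" "\<bar>x $ k\<bar>" "t n"] by linarith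
      then have "\<bar>vec_prod x \<alpha> I\<bar> * exp (t n * x $ k) \<le> exp (real (card I) * ?L x) * exp (?L x)"
        by (intro mult_mono abs_vec_prod_le) auto
      then show "\<bar>vec_prod x \<alpha> I * exp (t n * x $ k)\<bar> \<le> exp (real (card I + 1) * ?L x)"
        by (simp add: abs_mult exp_add[symmetric] algebra_simps)
    qed measurable
    note diff = Bochner_Integration.integral_diff[OF this integrable_gauss_vec_prod[of \<alpha> I]]
    have "gauss_density R x * (vec_prod x \<alpha> I * ((exp (t n * x $ k) - 1) / t n)) =
        (gauss_density R x * (vec_prod x \<alpha> I * exp (t n * x $ k)) -
          gauss_density R x * vec_prod x \<alpha> I) / t n" for x
      using t[of n] by (simp add: field_simps)
    then show ?thesis
      by (simp only: gauss_mean_def Bochner_Integration.integral_divide_zero diff)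
  qed
  have "(\<lambda>n. gauss_mean (\<lambda>x. vec_prod x \<alpha> I * ((exp (t n * x $ k) - 1) / t n)))
      \<longlonglongrightarrow> gauss_mean (\<lambda>x. vec_prod x \<alpha> I * x $ k)"
    unfolding gauss_mean_def
  proof (rule integral_dominated_convergence)
    show "integrable lborel (\<lambda>x. gauss_density R x * exp (real (card I + 2) * ?L x))"
      by (rule integrable_gauss_exp_abs)
    show "AE x in lborel. (\<lambda>n. gauss_density R x * (vec_prod x \<alpha> I * ((exp (t n * x $ k) - 1) / t n)))
        \<longlonglongrightarrow> gauss_density R x * (vec_prod x \<alpha> I * x $ k)"
    proof (rule AE_I2)
      fix x :: "real^'d"
      have "((\<lambda>t. exp (t * x $ k)) has_real_derivative x $ k) (at 0)"
        by (auto intro!: derivative_eq_intros)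
      then have "((\<lambda>h. (exp (h * x $ k) - 1) / h) \<longlongrightarrow> x $ k) (at 0)"
        by (simp add: DERIV_def)
      then have "(\<lambda>n. (exp (t n * x $ k) - 1) / t n) \<longlonglongrightarrow> x $ k"
        by (rule filterlim_compose) (use t t0 in \<open>auto simp: filterlim_at less_le\<close>)
      then show "(\<lambda>n. gauss_density R x * (vec_prod x \<alpha> I * ((exp (t n * x $ k) - 1) / t n)))
        \<longlonglongrightarrow> gauss_density R x * (vec_prod x \<alpha> I * x $ k)"
        by (intro tendsto_intros)
    qed
    show "AE x in lborel. norm (gauss_density R x * (vec_prod x \<alpha> I * ((exp (t n * x $ k) - 1) / t n)))
        \<le> gauss_density R x * exp (real (card I + 2) * ?L x)" for n
    proof (rule AE_I2)
      fix x :: "real^'d"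
      have "\<bar>(exp (t n * x $ k) - 1) / t n\<bar> \<le> exp (2 * ?L x)"
        by (rule order_trans[OF abs_exp_difference_quotient_le[OF t]]) (simp add: kL)
      then have "\<bar>vec_prod x \<alpha> I\<bar> * \<bar>(exp (t n * x $ k) - 1) / t n\<bar>
          \<le> exp (real (card I) * ?L x) * exp (2 * ?L x)"
        by (intro mult_mono abs_vec_prod_le) auto
      also have "\<dots> = exp (real (card I + 2) * ?L x)"
        by (simp add: exp_add[symmetric] algebra_simps)
      finally show "norm (gauss_density R x * (vec_prod x \<alpha> I * ((exp (t n * x $ k) - 1) / t n)))
        \<le> gauss_density R x * exp (real (card I + 2) * ?L x)"
        using gauss_density_nonneg[of x] by (auto simp only: real_norm_def abs_mult abs_of_nonneg intro!: mult_left_mono)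
    qed
  qed measurable
  then show ?thesis
    by (simp only: q)
qed

text \<open>
  Both sides are the derivative at \<open>t = 0\<close> of the mean of \<open>x\<^sub>I * exp (t * x\<^sub>k)\<close>. By the Cameron--Martin
  formula that mean is \<open>F t\<close>, an explicit Gaussian factor, stationary at \<open>0\<close>, times a polynomial in
  \<open>t\<close> whose linear coefficient comes from the one-element subsets of \<open>I\<close>.
\<close>

lemma gauss_mean_integration_by_parts:
  assumes "finite I"
  shows "gauss_mean (\<lambda>x. vec_prod x \<alpha> I * x $ k) =
    (\<Sum>j\<in>I. R $ \<alpha> j $ k * gauss_mean (\<lambda>x. vec_prod x \<alpha> (I - {j})))"
proof -
  let ?m = "\<lambda>S. gauss_mean (\<lambda>x. vec_prod x \<alpha> S)"
  let ?v = "R *v axis k 1"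
  let ?c = "1 / 2 * (axis k 1 \<bullet> ?v)"
  define F where "F t = exp (?c * t ^ 2) * (\<Sum>S\<in>Pow I. t ^ card S * (vec_prod ?v \<alpha> S * ?m (I - S)))" for t
  have F: "gauss_mean (\<lambda>x. vec_prod x \<alpha> I * exp (t * x $ k)) = F t" for t
  proof -
    have "axis k 1 \<bullet> x = x $ k" for x :: "real^'d"
      by (simp add: inner_axis')
    then show ?thesis
      using gauss_mean_translate[of "\<lambda>x. vec_prod x \<alpha> I" "t *\<^sub>R axis k 1"]
      by (simp add: F_def gauss_mean_vec_prod_add[OF assms] matrix_vector_mult_scaleR
          vec_prod_scaleR power2_eq_square mult_ac)
  qed
  have F0: "F 0 = ?m I"
    using F[of 0] by simp
  \<comment> \<open>only terms with \<open>card S = 1\<close> survive: \<open>0 ^ (card S - 1)\<close> is \<open>1\<close> also for the empty set, but there the factor \<open>card S\<close> is \<open>0\<close>\<close>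
  let ?D = "\<Sum>S\<in>Pow I. real (card S) * 0 ^ (card S - 1) * (vec_prod ?v \<alpha> S * ?m (I - S))"
  have "(F has_real_derivative ?D) (at 0)"
    unfolding F_def[abs_def] by (auto intro!: derivative_eq_intros sum.cong)
  then have "((\<lambda>h. (F h - F 0) / h) \<longlongrightarrow> ?D) (at 0)"
    by (simp add: DERIV_def)
  moreover have "filterlim (\<lambda>n. 1 / real (Suc n)) (at 0) sequentially"
    using LIMSEQ_Suc[OF lim_1_over_n[where 'a=real]] by (simp add: filterlim_at)
  ultimately have "(\<lambda>n. (F (1 / real (Suc n)) - F 0) / (1 / real (Suc n))) \<longlonglongrightarrow> ?D"
    by (rule filterlim_compose)
  then have "gauss_mean (\<lambda>x. vec_prod x \<alpha> I * x $ k) = ?D"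
    using gauss_mean_exp_quotient_tendsto[of \<alpha> I k] LIMSEQ_unique unfolding F F0 by blast
  also have "?D = (\<Sum>S\<in>(\<lambda>j. {j}) ` I. vec_prod ?v \<alpha> S * ?m (I - S))"
  proof (rule sum.mono_neutral_cong_right)
    have "card S = 0 \<or> 1 < card S" if "S \<in> Pow I - (\<lambda>j. {j}) ` I" for S
      using that card_1_singletonE[of S] by (cases "card S = 1") auto
    then show "\<forall>S\<in>Pow I - (\<lambda>j. {j}) ` I.
        real (card S) * 0 ^ (card S - 1) * (vec_prod ?v \<alpha> S * ?m (I - S)) = 0"
      by fastforce
  qed (use assms in auto)
  also have "\<dots> = (\<Sum>j\<in>I. R $ \<alpha> j $ k * ?m (I - {j}))"
    by (subst sum.reindex)
      (auto simp: vec_prod_def matrix_vector_mul_component inner_axis)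
  finally show ?thesis .
qed

text \<open>
  The theorem of Isserlis and Wick. Moments and pairing sums satisfy the same recursion, once the entry
  of \<open>R\<close> in integration by parts is read as the second moment of the two coordinates.
\<close>

lemma gauss_mean_wick:
  assumes "finite I"
  shows "gauss_mean (\<lambda>x. vec_prod x \<alpha> I) =
    (\<Sum>\<sigma>\<in>pairings I. \<Prod>p\<in>\<sigma>. gauss_mean (\<lambda>x. vec_prod x \<alpha> p))"
  using assms
proof (induction "card I" arbitrary: I rule: less_induct)
  case less
  show ?case
  proof (cases "I = {}")
    case True
    then show ?thesis
      by (simp add: pairings_empty gauss_mean_one)
  next
    case False
    then obtain k J where I: "I = insert k J" "k \<notin> J"
      by (metis Set.set_insert all_not_in_conv)
    have J: "finite J"
      using less.prems I by simp
    have step: "gauss_mean (\<lambda>x. vec_prod x \<alpha> (insert k K)) =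
        (\<Sum>j\<in>K. R $ \<alpha> j $ \<alpha> k * gauss_mean (\<lambda>x. vec_prod x \<alpha> (K - {j})))"
      if "finite K" "k \<notin> K" for K
      using gauss_mean_integration_by_parts[OF that(1), of \<alpha> "\<alpha> k"] that
      by (simp add: vec_prod_insert mult.commute)
    have pair: "gauss_mean (\<lambda>x. vec_prod x \<alpha> {k, j}) = R $ \<alpha> j $ \<alpha> k" if "j \<in> J" for j
      using step[of "{j}"] that I by (auto simp: gauss_mean_one)
    have IH: "gauss_mean (\<lambda>x. vec_prod x \<alpha> (J - {j})) =
        (\<Sum>\<sigma>\<in>pairings (J - {j}). \<Prod>p\<in>\<sigma>. gauss_mean (\<lambda>x. vec_prod x \<alpha> p))" if "j \<in> J" for j
      by (rule less.hyps) (use I J in \<open>auto simp: card_insert_if less_Suc_eq_le card_mono\<close>)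
    show ?thesis
      unfolding I(1) sum_pairings_insert[OF J I(2)] step[OF J I(2)]
      by (intro sum.cong refl) (simp add: pair IH)
  qed
qed

text \<open>
  A set of odd size has no pairing, since a pairing covers twice as many positions as it has pairs.
\<close>

lemma gauss_mean_odd:
  assumes "finite I" "odd (card I)"
  shows "gauss_mean (\<lambda>x. vec_prod x \<alpha> I) = 0"
proof -
  have "pairings I = {}"
  proof (rule ccontr)
    assume "pairings I \<noteq> {}"
    then obtain \<sigma> where \<sigma>: "\<sigma> \<in> pairings I" by blast
    then have p: "I = \<Union>\<sigma>" "pairwise disjnt \<sigma>" "\<And>p. p \<in> \<sigma> \<Longrightarrow> card p = 2"
      by (auto simp: pairings_def partition_on_def)
    have "card I = (\<Sum>p\<in>\<sigma>. card p)"
      unfolding p(1) by (rule card_Union_disjoint[OF p(2)]) (metis p(3) card.infinite zero_neq_numeral)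
    then have "card I = 2 * card \<sigma>"
      by (simp add: p(3))
    then show False
      using assms(2) by simp
  qed
  then show ?thesis
    by (simp add: gauss_mean_wick[OF assms(1)])
qed

section \<open>The symmetric mixture\<close>

text \<open>
  Translating back the two halves of the mixture turns the integral into the average of the means of
  \<open>(- \<mu> + x)\<^sub>I\<close> and \<open>(\<mu> + x)\<^sub>I\<close>; the coefficient of \<open>\<mu>\<^sub>S\<close> is then \<open>((-1) ^ card S + 1) / 2\<close>, which
  selects the even subsets.
\<close>

lemma
  assumes "finite I"
  shows integrable_mixture_vec_prod:
      "integrable lborel (\<lambda>x. mixture_density R \<mu> x * vec_prod x \<alpha> I)"
    and integral_mixture_vec_prod:
      "(\<integral>x. mixture_density R \<mu> x * vec_prod x \<alpha> I \<partial>lborel) =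
        (\<Sum>S | S \<subseteq> I \<and> even (card S). vec_prod \<mu> \<alpha> S * gauss_mean (\<lambda>x. vec_prod x \<alpha> (I - S)))"
proof -
  let ?m = "\<lambda>S. gauss_mean (\<lambda>x. vec_prod x \<alpha> S)"
  have trans: "integrable lborel (\<lambda>x. gauss_density R (x - v) * vec_prod x \<alpha> I)"
    "(\<integral>x. gauss_density R (x - v) * vec_prod x \<alpha> I \<partial>lborel) = gauss_mean (\<lambda>x. vec_prod (v + x) \<alpha> I)"
    for v
    using integrable_lborel_translate[of "\<lambda>x. gauss_density R (x - v) * vec_prod x \<alpha> I" v]
      integral_lborel_translate[of "\<lambda>x. gauss_density R (x - v) * vec_prod x \<alpha> I" v]
      integrable_gauss_vec_prod_add[OF assms, of v \<alpha>]
    by (auto simp: gauss_mean_def add.commute)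
  have split: "mixture_density R \<mu> x * vec_prod x \<alpha> I =
      1 / 2 * (gauss_density R (x - - \<mu>) * vec_prod x \<alpha> I) +
      1 / 2 * (gauss_density R (x - \<mu>) * vec_prod x \<alpha> I)" for x
    by (simp add: mixture_density_def algebra_simps)
  show "integrable lborel (\<lambda>x. mixture_density R \<mu> x * vec_prod x \<alpha> I)"
    unfolding split
    by (intro Bochner_Integration.integrable_add integrable_mult_right trans)
  have "(\<integral>x. mixture_density R \<mu> x * vec_prod x \<alpha> I \<partial>lborel) =
      1 / 2 * gauss_mean (\<lambda>x. vec_prod (- \<mu> + x) \<alpha> I) + 1 / 2 * gauss_mean (\<lambda>x. vec_prod (\<mu> + x) \<alpha> I)"
    unfolding split trans(2)[symmetric]
    by (subst Bochner_Integration.integral_add)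
      (intro integrable_mult_right trans(1) | simp only: integral_mult_right_zero)+
  also have "\<dots> = (\<Sum>S\<in>Pow I. 1 / 2 * ((- 1) ^ card S + 1) * (vec_prod \<mu> \<alpha> S * ?m (I - S)))"
    unfolding gauss_mean_vec_prod_add[OF assms] vec_prod_minus
    by (simp add: sum_distrib_left flip: sum.distrib) (simp add: algebra_simps add_divide_distrib)
  also have "\<dots> = (\<Sum>S | S \<subseteq> I \<and> even (card S). vec_prod \<mu> \<alpha> S * ?m (I - S))"
    by (rule sum.mono_neutral_cong_right) (use assms in auto)
  finally show "(\<integral>x. mixture_density R \<mu> x * vec_prod x \<alpha> I \<partial>lborel) =
      (\<Sum>S | S \<subseteq> I \<and> even (card S). vec_prod \<mu> \<alpha> S * ?m (I - S))" .
qed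

end

theorem theorem2:
  fixes \<mu> :: "real^'d" and R :: "real^'d^'d"
    and M :: "'a measure" and X :: "'a \<Rightarrow> real^'d"
    and M' :: "'b measure" and \<zeta> :: "'b \<Rightarrow> real^'d"
    and N :: nat and \<alpha> :: "nat \<Rightarrow> 'd"
  assumes R: "sym_pos_def R"
    and M: "prob_space M"
    and X: "distributed M lborel X (\<lambda>x. ennreal (mixture_density R \<mu> x))"
    and M': "prob_space M'"
    and \<zeta>: "distributed M' lborel \<zeta> (\<lambda>x. ennreal (gauss_density R x))"
  shows "(integrable M (\<lambda>\<omega>. vec_prod (X \<omega>) \<alpha> {1..2 * N}) \<and>
          prob_space.expectation M (\<lambda>\<omega>. vec_prod (X \<omega>) \<alpha> {1..2 * N}) =
            (\<Sum>k = 0..N. \<Sum>S | S \<subseteq> {1..2 * N} \<and> card S = 2 * k.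
               vec_prod \<mu> \<alpha> S * sum_prod_pairings M' \<zeta> \<alpha> ({1..2 * N} - S))) \<and>
         (integrable M (\<lambda>\<omega>. vec_prod (X \<omega>) \<alpha> {1..2 * N + 1}) \<and>
          prob_space.expectation M (\<lambda>\<omega>. vec_prod (X \<omega>) \<alpha> {1..2 * N + 1}) = 0)"
proof -
  have "(\<integral>\<^sup>+x. ennreal (gauss_density R x) \<partial>lborel) = 1"
    using distributed_nn_integral[OF \<zeta>, of "\<lambda>_. 1"] prob_space.emeasure_space_1[OF M'] by simp
  with R interpret gaussian_law R
    by unfold_locales
  have mix: "0 \<le> mixture_density R \<mu> x" for x
    by (simp add: mixture_density_def gauss_density_nonneg)
  have X_int: "integrable M (\<lambda>\<omega>. vec_prod (X \<omega>) \<alpha> I)"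
    and X_mean: "prob_space.expectation M (\<lambda>\<omega>. vec_prod (X \<omega>) \<alpha> I) =
      (\<Sum>S | S \<subseteq> I \<and> even (card S). vec_prod \<mu> \<alpha> S * gauss_mean (\<lambda>x. vec_prod x \<alpha> (I - S)))"
    if "finite I" for I
    using distributed_integrable[OF X, of "\<lambda>x. vec_prod x \<alpha> I"]
      distributed_integral[OF X, of "\<lambda>x. vec_prod x \<alpha> I"]
      integrable_mixture_vec_prod[OF that] integral_mixture_vec_prod[OF that] mix
    by auto
  have "prob_space.expectation M' (\<lambda>\<omega>. vec_prod (\<zeta> \<omega>) \<alpha> p) = gauss_mean (\<lambda>x. vec_prod x \<alpha> p)" for p
    using distributed_integral[OF \<zeta>, of "\<lambda>x. vec_prod x \<alpha> p"]
    by (simp add: gauss_mean_def gauss_density_nonneg)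
  then have wick: "gauss_mean (\<lambda>x. vec_prod x \<alpha> I) = sum_prod_pairings M' \<zeta> \<alpha> I" if "finite I" for I
    using gauss_mean_wick[OF that] by (simp add: sum_prod_pairings_def)
  have "prob_space.expectation M (\<lambda>\<omega>. vec_prod (X \<omega>) \<alpha> {1..2 * N}) =
      (\<Sum>k = 0..N. \<Sum>S | S \<subseteq> {1..2 * N} \<and> card S = 2 * k.
         vec_prod \<mu> \<alpha> S * sum_prod_pairings M' \<zeta> \<alpha> ({1..2 * N} - S))"
    by (simp add: X_mean wick sum_even_subsets_by_card[where N = N])
  moreover have "prob_space.expectation M (\<lambda>\<omega>. vec_prod (X \<omega>) \<alpha> {1..2 * N + 1}) = 0"
  proof -
    have "gauss_mean (\<lambda>x. vec_prod x \<alpha> ({1..2 * N + 1} - S)) = 0"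
      if "S \<subseteq> {1..2 * N + 1}" "even (card S)" for S
    proof (rule gauss_mean_odd)
      have "card ({1..2 * N + 1} - S) + card S = 2 * N + 1"
        using that card_Diff_subset[of S "{1..2 * N + 1}"] card_mono[of "{1..2 * N + 1}" S]
          finite_subset[of S "{1..2 * N + 1}"] by simp
      then show "odd (card ({1..2 * N + 1} - S))"
        using that(2) by presburger
    qed simp
    then show ?thesis
      by (simp add: X_mean del: One_nat_def)
  qed
  ultimately show ?thesis
    using X_int by simp
qed

end
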